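(* Let $V=\bigoplus_{n\in\mathbb{Z}}V_n$ be an $\mathcal{H}$-module vertex algebra. Set $L_1^{+}V=\sum_{n\ge 1}L_1^{(n)}V$, a $\mathbb{Z}$-graded subspace of $V$, and let $(L_1^{+}V)_0=L_1^{+}V\cap V_0$ be its degree-zero part. Then the space of all invariant bilinear forms on $V$ (all of which are symmetric) is linearly isomorphic to the dual space $\bigl(V_0/(L_1^{+}V)_0\bigr)^{*}$.
   Context: Throughout, $\mathbb{F}$ is an algebraically closed field of odd prime characteristic $p$, and vertex algebras and their modules are over $\mathbb{F}$ (defined by the usual vacuum, truncation and creation axioms together with the Jacobi identity). Every vertex algebra $V$ is a module for the bialgebra $\mathcal{B}$ with basis $\{\mathcal{D}^{(n)}\}_{n\in\mathbb{N}}$, $\mathcal{D}^{(m)}\mathcal{D}^{(n)}=\binom{m+n}{n}\mathcal{D}^{(m+n)}$, via $\mathcal{D}^{(n)}v=v_{-n-1}\mathbf{1}$. The bialgebra $\mathcal{H}$: let $\mathfrak{sl}_2$ over $\mathbb{C}$ have basis $L_{-1},L_0,L_1$ with $[L_1,L_{-1}]=2L_0$, $[L_0,L_{\pm1}]=\mp L_{\pm1}$; in $U(\mathfrak{sl}_2)$ put $L_{\pm1}^{(n)}=L_{\pm1}^n/n!$ and $L_0^{(n)}=\binom{-2L_0}{n}$; let $U(\mathfrak{sl}_2)_{\mathbb{Z}}$ be the $\mathbb{Z}$-span of all $L_{-1}^{(i)}L_0^{(j)}L_1^{(k)}$ (a subring and Hopf $\mathbb{Z}$-form), and $\mathcal{H}=\mathbb{F}\otimes_{\mathbb{Z}}U(\mathfrak{sl}_2)_{\mathbb{Z}}$,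 a Hopf algebra with $\Delta(L_{\pm1}^{(n)})=\sum_{i}L_{\pm1}^{(n-i)}\otimes L_{\pm1}^{(i)}$, $\Delta(L_0^{(n)})=\sum_i L_0^{(n-i)}\otimes L_0^{(i)}$, $\varepsilon(L_{\pm1}^{(n)})=\varepsilon(L_0^{(n)})=\delta_{n,0}$. Let $\theta$ be the anti-automorphism of $\mathcal{H}$ with $\theta(L_{\pm1}^{(n)})=L_{\mp1}^{(n)}$, $\theta(L_0^{(n)})=L_0^{(n)}$. Write $e^{zL_{\pm1}}=\sum_{n\ge0}z^nL_{\pm1}^{(n)}$. For a $\mathbb{Z}$-graded space and $v$ homogeneous of degree $n$, $f(z)^{\deg}v$ means $f(z)^{n}v$ (extended linearly), e.g. $(1-zz_0)^{-2\deg}v=(1-zz_0)^{-2n}v$, $(-z^{-2})^{\deg}v=(-1)^nz^{-2n}v$. A $\mathbb{Z}$-graded vertex algebra is a vertex algebra $V=\bigoplus_{n\in\mathbb{Z}}V_n$ with $\mathbf{1}\in V_0$ and $u_rV_n\subset V_{m+n-r-1}$ for $u\in V_m$. A $\mathbb{Z}$-graded weight $\mathcal{H}$-module is a $\mathbb{Z}$-graded space $W=\bigoplus W_n$ with an $\mathcal{H}$-action such that $L_{\pm1}^{(r)}W_n\subset W_{n\mp r}$ and $L_0^{(r)}$ acts on $W_n$ as the scalar $\binom{-2n}{r}$. An $\mathcal{H}$-module vertex algebra is a $\mathbb{Z}$-graded vertex algebra $V$ which is also a $\mathbb{Z}$-graded weight $\mathcal{H}$-module with $L_{-1}^{(n)}=\mathcal{D}^{(n)}$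 on $V$ for all $n$, such that (i) $V_n=0$ for $n$ sufficiently negative, (ii) $L_1^{(n)}\mathbf{1}=\delta_{n,0}\mathbf{1}$ for $n\in\mathbb{N}$, and (iii) $e^{zL_1}Y(v,z_0)e^{-zL_1}=Y\bigl(e^{z(1-zz_0)L_1}(1-zz_0)^{-2\deg}v,\,z_0/(1-zz_0)\bigr)$ for all $v\in V$. A bilinear form $(\cdot,\cdot)$ on $V$ is invariant if $(Y(v,z)w,w')=(w,Y(e^{zL_1}(-z^{-2})^{\deg}v,z^{-1})w')$ for all $v,w,w'\in V$, and $(aw,w')=(w,\theta(a)w')$ for all $a\in\mathcal{H}$, $w,w'\in V$. *)

theory Defs
  imports Main "HOL-Computational_Algebra.Polynomial"
begin

definition alg_closed :: "'k::field itself \<Rightarrow> bool" where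
  "alg_closed _ \<longleftrightarrow> (\<forall>q::'k poly. degree q > 0 \<longrightarrow> (\<exists>x. poly q x = 0))"

text \<open>Integer binomial coefficient binom(m,i) for m an integer
  (the usual (m(m-1)...(m-i+1))/i!, an integer); it is mapped into the field via of_int.\<close>
definition ibinom :: "int \<Rightarrow> nat \<Rightarrow> int" where
  "ibinom m i = (if m \<ge> 0 then int (nat m choose i)
                 else (-1) ^ i * int ((nat (- m) + i - 1) choose i))"

text \<open>Sum of a finitely supported family (all sums below are finite by the truncation
  axioms / lower-boundedness of the grading).\<close>
definition fsum :: "('i \<Rightarrow> 'a::comm_monoid_add) \<Rightarrow> 'a" where
  "fsum f = sum f {i. f i \<noteq> 0}"

definition isign :: "int \<Rightarrow> 'a::ring_1" where
  "isign l = (if even l then 1 else -1)"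

definition graded :: "('k::field \<Rightarrow> 'v::ab_group_add \<Rightarrow> 'v) \<Rightarrow> (int \<Rightarrow> 'v set) \<Rightarrow> bool" where
  "graded sc Vg \<longleftrightarrow> (\<forall>n. module.subspace sc (Vg n)) \<and>
     (\<forall>v. \<exists>!c. finite {n. c n \<noteq> 0} \<and> (\<forall>n. c n \<in> Vg n) \<and> v = sum c {n. c n \<noteq> 0})"

definition comp :: "(int \<Rightarrow> 'v::ab_group_add set) \<Rightarrow> int \<Rightarrow> 'v \<Rightarrow> 'v" where
  "comp Vg n v = (THE c. finite {n. c n \<noteq> 0} \<and> (\<forall>n. c n \<in> Vg n) \<and> v = sum c {n. c n \<noteq> 0}) n"

text \<open>mode u n v is u_n v, i.e. Y(u,z)v = sum_n (u_n v) z^(-n-1).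
  The Jacobi identity is stated in its equivalent component form (Borcherds identity),
  obtained by taking coefficients of the formal Jacobi identity.\<close>
definition vertex_algebra ::
  "('k::field \<Rightarrow> 'v::ab_group_add \<Rightarrow> 'v) \<Rightarrow> 'v \<Rightarrow> ('v \<Rightarrow> int \<Rightarrow> 'v \<Rightarrow> 'v) \<Rightarrow> bool" where
  "vertex_algebra sc vac mode \<longleftrightarrow>
     vector_space sc \<and>
     (\<forall>n. \<forall>u1 u2 v. mode (u1 + u2) n v = mode u1 n v + mode u2 n v) \<and>
     (\<forall>n. \<forall>a u v. mode (sc a u) n v = sc a (mode u n v)) \<and>
     (\<forall>n. \<forall>u v1 v2. mode u n (v1 + v2) = mode u n v1 + mode u n v2) \<and>
     (\<forall>n. \<forall>a u v. mode u n (sc a v) = sc a (mode u n v)) \<and>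
     (\<forall>u v. \<exists>N. \<forall>n\<ge>N. mode u n v = 0) \<and>
     (\<forall>n v. mode vac n v = (if n = -1 then v else 0)) \<and>
     (\<forall>u. \<forall>n\<ge>0. mode u n vac = 0) \<and>
     (\<forall>u. mode u (-1) vac = u) \<and>
     (\<forall>u v w. \<forall>m n l::int.
        fsum (\<lambda>i::nat. sc (of_int (ibinom m i)) (mode (mode u (l + int i) v) (m + n - int i) w))
      = fsum (\<lambda>i::nat. sc (of_int ((-1) ^ i * ibinom l i))
            (mode u (m + l - int i) (mode v (n + int i) w)
             - sc (isign l) (mode v (n + l - int i) (mode u (m + int i) w)))))"

definition Dop :: "('v \<Rightarrow> int \<Rightarrow> 'v \<Rightarrow> 'v) \<Rightarrow> 'v \<Rightarrow> nat \<Rightarrow> 'v \<Rightarrow> 'v" where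
  "Dop mode vac n v = mode v (- int n - 1) vac"

definition Z_graded_VA ::
  "('k::field \<Rightarrow> 'v::ab_group_add \<Rightarrow> 'v) \<Rightarrow> (int \<Rightarrow> 'v set) \<Rightarrow> 'v \<Rightarrow> ('v \<Rightarrow> int \<Rightarrow> 'v \<Rightarrow> 'v) \<Rightarrow> bool" where
  "Z_graded_VA sc Vg vac mode \<longleftrightarrow>
     vertex_algebra sc vac mode \<and> graded sc Vg \<and> vac \<in> Vg 0 \<and>
     (\<forall>m n r u v. u \<in> Vg m \<longrightarrow> v \<in> Vg n \<longrightarrow> mode u r v \<in> Vg (m + n - r - 1))"

text \<open>An H-module structure on a Z-graded space W on which L_0^(r) acts on W_n by the
  scalar binom(-2n,r) is given by the actions Lm r = L_(-1)^(r) and Lp r = L_1^(r),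
  subject to the defining relations of the Kostant Z-form U(sl_2)_Z (base-changed to F):
  divided power relations and the commutation formula
  L_1^(a) L_(-1)^(b) = sum_k (-1)^k L_(-1)^(b-k) binom(-2L_0 + a - b ... ) L_1^(a-k)
  (evaluated on W_n), with e = L_1, f = -L_(-1), h = -2L_0.\<close>
definition weight_H_module ::
  "('k::field \<Rightarrow> 'v::ab_group_add \<Rightarrow> 'v) \<Rightarrow> (int \<Rightarrow> 'v set) \<Rightarrow> (nat \<Rightarrow> 'v \<Rightarrow> 'v) \<Rightarrow> (nat \<Rightarrow> 'v \<Rightarrow> 'v) \<Rightarrow> bool" where
  "weight_H_module sc Vg Lm Lp \<longleftrightarrow>
     vector_space sc \<and> graded sc Vg \<and>
     (\<forall>r. Vector_Spaces.linear sc sc (Lm r)) \<and> (\<forall>r. Vector_Spaces.linear sc sc (Lp r)) \<and>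
     (\<forall>v. Lm 0 v = v) \<and> (\<forall>v. Lp 0 v = v) \<and>
     (\<forall>m n v. Lm m (Lm n v) = sc (of_nat ((m + n) choose n)) (Lm (m + n) v)) \<and>
     (\<forall>m n v. Lp m (Lp n v) = sc (of_nat ((m + n) choose n)) (Lp (m + n) v)) \<and>
     (\<forall>n a b v. v \<in> Vg n \<longrightarrow>
        Lp a (Lm b v) = (\<Sum>k\<le>min a b. sc (of_int ((-1) ^ k * ibinom (-2 * n + int a - int b) k))
                                          (Lm (b - k) (Lp (a - k) v)))) \<and>
     (\<forall>r n v. v \<in> Vg n \<longrightarrow> Lm r v \<in> Vg (n + int r)) \<and>
     (\<forall>r n v. v \<in> Vg n \<longrightarrow> Lp r v \<in> Vg (n - int r))"

definition L0op :: "('k::field \<Rightarrow> 'v::ab_group_add \<Rightarrow> 'v) \<Rightarrow> (int \<Rightarrow> 'v set) \<Rightarrow> nat \<Rightarrow> 'v \<Rightarrow> 'v" where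
  "L0op sc Vg j v = fsum (\<lambda>n. sc (of_int (ibinom (-2 * n) j)) (comp Vg n v))"

definition Hbasis_act ::
  "('k::field \<Rightarrow> 'v::ab_group_add \<Rightarrow> 'v) \<Rightarrow> (int \<Rightarrow> 'v set) \<Rightarrow> (nat \<Rightarrow> 'v \<Rightarrow> 'v) \<Rightarrow> (nat \<Rightarrow> 'v \<Rightarrow> 'v)
     \<Rightarrow> nat \<Rightarrow> nat \<Rightarrow> nat \<Rightarrow> 'v \<Rightarrow> 'v" where
  "Hbasis_act sc Vg Lm Lp i j k v = Lm i (L0op sc Vg j (Lp k v))"

text \<open>Condition (iii), coefficient of z^N z0^M applied to w, for v homogeneous of degree d:
  LHS  sum_(a+b=N) (-1)^b L_1^(a) v_(-M-1) L_1^(b) w,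
  RHS  sum_(j=0..N) (-1)^j binom(N-2d-M, j) (L_1^(N-j) v)_(j-M-1) w.\<close>
definition H_module_VA ::
  "('k::field \<Rightarrow> 'v::ab_group_add \<Rightarrow> 'v) \<Rightarrow> (int \<Rightarrow> 'v set) \<Rightarrow> 'v \<Rightarrow> ('v \<Rightarrow> int \<Rightarrow> 'v \<Rightarrow> 'v)
     \<Rightarrow> (nat \<Rightarrow> 'v \<Rightarrow> 'v) \<Rightarrow> (nat \<Rightarrow> 'v \<Rightarrow> 'v) \<Rightarrow> bool" where
  "H_module_VA sc Vg vac mode Lm Lp \<longleftrightarrow>
     Z_graded_VA sc Vg vac mode \<and> weight_H_module sc Vg Lm Lp \<and>
     (\<forall>n v. Lm n v = Dop mode vac n v) \<and>
     (\<exists>N. \<forall>n<N. Vg n = {0}) \<and>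
     (\<forall>n. Lp n vac = (if n = 0 then vac else 0)) \<and>
     (\<forall>d v w. \<forall>N::nat. \<forall>M::int. v \<in> Vg d \<longrightarrow>
        (\<Sum>a\<le>N. sc ((-1) ^ (N - a)) (Lp a (mode v (- M - 1) (Lp (N - a) w))))
      = (\<Sum>j\<le>N. sc (of_int ((-1) ^ j * ibinom (int N - 2 * d - M) j))
                    (mode (Lp (N - j) v) (int j - M - 1) w)))"

definition bilinear_form :: "('k::field \<Rightarrow> 'v::ab_group_add \<Rightarrow> 'v) \<Rightarrow> ('v \<Rightarrow> 'v \<Rightarrow> 'k) \<Rightarrow> bool" where
  "bilinear_form sc B \<longleftrightarrow>
     (\<forall>x y z. B (x + y) z = B x z + B y z) \<and> (\<forall>a x z. B (sc a x) z = a * B x z) \<and>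
     (\<forall>x y z. B z (x + y) = B z x + B z y) \<and> (\<forall>a x z. B z (sc a x) = a * B z x)"

text \<open>Invariance: for v homogeneous of degree d, the coefficient of z^(-n-1) in
  (Y(v,z)w,w') = (w, Y(e^(zL_1)(-z^(-2))^deg v, z^(-1)) w') reads
  (v_n w, w') = (-1)^d sum_(k>=0) (w, (L_1^(k) v)_(2d-n-k-2) w');
  and (aw,w') = (w, theta(a) w') for the basis elements a = L_(-1)^(i) L_0^(j) L_1^(k) of H,
  theta(a) = L_(-1)^(k) L_0^(j) L_1^(i).\<close>
definition invariant_form ::
  "('k::field \<Rightarrow> 'v::ab_group_add \<Rightarrow> 'v) \<Rightarrow> (int \<Rightarrow> 'v set) \<Rightarrow> ('v \<Rightarrow> int \<Rightarrow> 'v \<Rightarrow> 'v)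
     \<Rightarrow> (nat \<Rightarrow> 'v \<Rightarrow> 'v) \<Rightarrow> (nat \<Rightarrow> 'v \<Rightarrow> 'v) \<Rightarrow> ('v \<Rightarrow> 'v \<Rightarrow> 'k) \<Rightarrow> bool" where
  "invariant_form sc Vg mode Lm Lp B \<longleftrightarrow>
     bilinear_form sc B \<and>
     (\<forall>d n v w w'. v \<in> Vg d \<longrightarrow>
        B (mode v n w) w' = isign d * fsum (\<lambda>k::nat. B w (mode (Lp k v) (2 * d - n - int k - 2) w'))) \<and>
     (\<forall>i j k w w'. B (Hbasis_act sc Vg Lm Lp i j k w) w' = B w (Hbasis_act sc Vg Lm Lp k j i w'))"

definition L1plus :: "('k::field \<Rightarrow> 'v::ab_group_add \<Rightarrow> 'v) \<Rightarrow> (nat \<Rightarrow> 'v \<Rightarrow> 'v) \<Rightarrow> 'v set" where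
  "L1plus sc Lp = module.span sc (\<Union>n\<in>{1..}. range (Lp n))"

text \<open>The dual space (V_0 / (L_1^+V)_0)^*, realized as the linear functionals on V_0 that
  vanish on (L_1^+V)_0 = L_1^+V \<inter> V_0 (extended by 0 outside V_0).\<close>
definition quot_dual ::
  "('k::field \<Rightarrow> 'v::ab_group_add \<Rightarrow> 'v) \<Rightarrow> (int \<Rightarrow> 'v set) \<Rightarrow> (nat \<Rightarrow> 'v \<Rightarrow> 'v) \<Rightarrow> ('v \<Rightarrow> 'k) set" where
  "quot_dual sc Vg Lp = {f.
     (\<forall>x\<in>Vg 0. \<forall>y\<in>Vg 0. f (x + y) = f x + f y) \<and> (\<forall>a. \<forall>x\<in>Vg 0. f (sc a x) = a * f x) \<and>
     (\<forall>x. x \<notin> Vg 0 \<longrightarrow> f x = 0) \<and> (\<forall>x\<in>L1plus sc Lp \<inter> Vg 0. f x = 0)}"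

end

theory Submission
  imports Defs "HOL-Computational_Algebra.Formal_Power_Series"
begin

text \<open>An invariant form is determined by the functional \<open>F = (\<one>, \<cdot>)\<close>, since
  \<open>(v, w) = (v\<^sub>-\<^sub>1 \<one>, w) = F (v'\<^sub>-\<^sub>1 w)\<close> with \<open>v'\<^sub>n\<close> the adjoint of \<open>v\<^sub>n\<close>. Invariance under
  \<open>L\<^sub>0\<close> and \<open>L\<^sub>-\<^sub>1\<close> forces \<open>F\<close> to vanish outside \<open>V\<^sub>0\<close> and on \<open>L\<^sub>1\<^sup>+ V\<close>. Conversely, for such an
  \<open>F\<close> define \<open>(v, w) = F (v'\<^sub>-\<^sub>1 w)\<close>. The adjoint modes satisfy the opposite Borcherds identity, and
  \<open>F\<close> is vacuum-like: \<open>F (v'\<^sub>n w) = 0\<close> for \<open>n \<ge> 0\<close>. Together these give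
  \<open>F ((v\<^sub>l u)'\<^sub>-\<^sub>1 w) = F (u'\<^sub>-\<^sub>1 v'\<^sub>l w)\<close>, which is invariance. Symmetry follows from
  \<open>(w, \<one>) = F w\<close> and \<open>v'' = v\<close>: \<open>(u, w) = (u'\<^sub>-\<^sub>1 w, \<one>) = (w, u\<^sub>-\<^sub>1 \<one>) = (w, u)\<close>.\<close>

section \<open>Binomial coefficients with integer upper index, over the integers and in prime
  characteristic\<close>

text \<open>Reduces integer identities to facts about \<open>gchoose\<close> over
  \<open>rat\<close>, where \<open>of_int\<close> is injective.\<close>

lemma of_int_ibinom: "of_int (ibinom m i) = ((of_int m :: rat) gchoose i)"
proof (cases "m \<ge> 0")
  case True
  then have "(of_int m :: rat) = of_nat (nat m)" by simp
  then show ?thesis using True by (simp add: ibinom_def binomial_gbinomial)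
next
  case False
  then have "(of_nat i - of_int m - 1 :: rat) = of_nat (nat (- m) + i - 1)"
    by simp
  then show ?thesis using False
    by (simp add: ibinom_def gbinomial_negated_upper[of "of_int m"] binomial_gbinomial)
qed

lemma ibinom_0_right [simp]: "ibinom m 0 = 1"
  by (simp add: ibinom_def)

lemma ibinom_int [simp]: "ibinom (int n) k = int (n choose k)"
  by (simp add: ibinom_def)

lemma ibinom_0_left: "ibinom 0 k = (if k = 0 then 1 else 0)"
  by (simp add: ibinom_def)

lemma ibinom_negated_upper: "(-1) ^ i * ibinom (int i - m - 1) i = ibinom m i"
proof -
  have "(of_int ((-1) ^ i * ibinom (int i - m - 1) i) :: rat) = of_int (ibinom m i)"
    by (simp add: of_int_ibinom gbinomial_negated_upper[of "of_int m"])
  then show ?thesis by (simp only: of_int_eq_iff)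
qed

lemma ibinom_minus_one: "ibinom (-1) r = (-1) ^ r"
  by (simp add: ibinom_def)

lemma ibinom_Vandermonde: "(\<Sum>i\<le>j. ibinom a i * ibinom b (j - i)) = ibinom (a + b) j"
proof -
  have "(of_int (\<Sum>i\<le>j. ibinom a i * ibinom b (j - i)) :: rat) = of_int (ibinom (a + b) j)"
    by (simp add: of_int_ibinom gbinomial_Vandermonde flip: atLeast0AtMost)
  then show ?thesis by (simp only: of_int_eq_iff)
qed

text \<open>The difference \<open>a - b\<close> is detected by the coefficient of top degree of
  \<open>(1 + x)\<^bsup>|a - b|\<^esup>\<close>, which is 1 in every characteristic.\<close>
lemma ibinom_separates:
  assumes "\<And>j. (of_int (ibinom a j) :: 'k::field) = of_int (ibinom b j)"
  shows "a = b"
proof -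
  have *: "a \<le> b" if h: "\<And>j. (of_int (ibinom a j) :: 'k) = of_int (ibinom b j)" for a b
  proof (rule ccontr)
    assume "\<not> a \<le> b"
    then obtain s where s: "a - b = int s" "s > 0"
      by (metis diff_gt_0_iff_gt not_le zero_less_imp_eq_int)
    \<comment> \<open>Convolution with the coefficients of \<open>(1 + x)^(-b)\<close> turns the
      hypothesis into \<open>binom(s, s) = binom(0, s)\<close>, that is
      \<open>1 = 0\<close>.\<close>
    have "(1::'k) = of_int (ibinom (a + (- b)) s)" using s by simp
    also have "\<dots> = (\<Sum>i\<le>s. of_int (ibinom a i) * of_int (ibinom (- b) (s - i)))"
      by (simp flip: ibinom_Vandermonde add: diff_conv_add_uminus del: add_uminus_conv_diff)
    also have "\<dots> = of_int (ibinom (b + (- b)) s)"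
      unfolding ibinom_Vandermonde[symmetric] by (simp add: h)
    also have "\<dots> = 0" using s by (simp add: ibinom_0_left)
    finally show False by simp
  qed
  show ?thesis using *[of a b] *[of b a] assms by force
qed

text \<open>Since \<open>p ^ k\<close> divides \<open>i * (p ^ k choose i)\<close>, a binomial
  coprime to \<open>p\<close> would force \<open>p ^ k\<close> to divide the smaller number
  \<open>i\<close>.\<close>

lemma prime_dvd_choose_power:
  assumes "prime p" "0 < i" "i < p ^ k"
  shows "p dvd (p ^ k choose i)"
proof (rule ccontr)
  assume "\<not> p dvd (p ^ k choose i)"
  then have "coprime (p ^ k) (p ^ k choose i)"
    using assms(1) by (simp add: prime_imp_coprime)
  moreover have "p ^ k dvd i * (p ^ k choose i)"
    by (metis assms(2) dvd_triv_left times_binomial_minus1_eq)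
  ultimately have "p ^ k dvd i" by (metis coprime_dvd_mult_left_iff)
  then show False using assms by (auto dest: dvd_imp_le)
qed

text \<open>By Pascal's rule neighbouring entries of row \<open>p ^ k - 1\<close> sum to an entry of
  row \<open>p ^ k\<close>, which is zero in the field.\<close>

lemma choose_prime_power_minus_one:
  assumes p: "prime p" "CHAR('k::field) = p" and "i < p ^ k"
  shows "(of_nat ((p ^ k - 1) choose i) :: 'k) = (-1) ^ i"
  using assms(3)
proof (induction i)
  case (Suc i)
  have "(of_nat (p ^ k choose Suc i) :: 'k) = 0"
    using prime_dvd_choose_power[OF p(1) _ Suc.prems] p(2) by (simp add: of_nat_eq_0_iff_char_dvd)
  moreover have "p ^ k choose Suc i = (p ^ k - 1 choose i) + (p ^ k - 1 choose Suc i)"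
    using Suc.prems by (metis Suc_pred' binomial_Suc_Suc gr_implies_not0 neq0_conv)
  ultimately show ?case using Suc by (simp add: add_eq_0_iff)
qed simp

section \<open>Finitely supported sums and signs\<close>

lemma fsum_eq_sum:
  assumes "finite A" "\<And>i. i \<notin> A \<Longrightarrow> f i = 0"
  shows "fsum f = sum f A"
  unfolding fsum_def by (rule sum.mono_neutral_left) (use assms in auto)

lemma eventually_fsum:
  assumes "\<forall>\<^sub>F i in sequentially. f i = 0"
  shows "\<forall>\<^sub>F I in sequentially. fsum f = (\<Sum>i<I. f i)"
proof -
  obtain N where N: "\<And>i. i \<ge> N \<Longrightarrow> f i = 0"
    using assms by (auto simp: eventually_sequentially)
  have "fsum f = (\<Sum>i<I. f i)" if "I \<ge> N" for I
    by (rule fsum_eq_sum) (use N that in auto)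
  then show ?thesis by (auto simp: eventually_sequentially)
qed

lemma fsum_single: "(\<And>i. i \<noteq> m \<Longrightarrow> f i = 0) \<Longrightarrow> fsum f = f m"
  by (subst fsum_eq_sum[of "{m}"]) auto

lemma isign_add: "isign (a + b) = (isign a * isign b :: 'a::ring_1)"
  by (simp add: isign_def)

lemma isign_diff: "isign (a - b) = (isign a * isign b :: 'a::ring_1)"
  by (simp add: isign_def)

lemma isign_of_nat: "isign (int n) = ((-1) ^ n :: 'a::ring_1)"
  by (simp add: isign_def)

lemma isign_1: "isign 1 = (-1 :: 'a::ring_1)"
  by (simp add: isign_def)

lemma isign_sq [simp]: "isign a * isign a = (1 :: 'a::ring_1)"
  by (simp add: isign_def)

section \<open>The axioms in usable form\<close>

locale H_VA =
  fixes sc :: "'k::field \<Rightarrow> 'v::ab_group_add \<Rightarrow> 'v"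
    and Vg :: "int \<Rightarrow> 'v set" and vac :: 'v and mode :: "'v \<Rightarrow> int \<Rightarrow> 'v \<Rightarrow> 'v"
    and Lm Lp :: "nat \<Rightarrow> 'v \<Rightarrow> 'v"
  assumes H: "H_module_VA sc Vg vac mode Lm Lp"
    and prime_char: "prime CHAR('k)"
begin

lemma Z_graded_VA: "Z_graded_VA sc Vg vac mode"
  and weight_H_module: "weight_H_module sc Vg Lm Lp"
  using H by (simp_all add: H_module_VA_def)

lemma vertex_algebra: "vertex_algebra sc vac mode" and graded: "graded sc Vg"
  using Z_graded_VA by (simp_all add: Z_graded_VA_def)

sublocale vs: vector_space sc
  using vertex_algebra by (simp add: vertex_algebra_def)

lemma mode_add_left: "mode (u1 + u2) n v = mode u1 n v + mode u2 n v"
  and mode_scale_left: "mode (sc a u) n v = sc a (mode u n v)"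
  and mode_add_right: "mode u n (v1 + v2) = mode u n v1 + mode u n v2"
  and mode_scale_right: "mode u n (sc a v) = sc a (mode u n v)"
  and mode_trunc: "\<exists>N. \<forall>n\<ge>N. mode u n v = 0"
  and mode_vac: "mode vac n v = (if n = -1 then v else 0)"
  and mode_creation: "mode u (-1) vac = u"
  using vertex_algebra unfolding vertex_algebra_def by simp_all

lemma borcherds: "fsum (\<lambda>i::nat. sc (of_int (ibinom m i)) (mode (mode u (l + int i) v) (m + n - int i) w))
      = fsum (\<lambda>i::nat. sc (of_int ((-1) ^ i * ibinom l i))
            (mode u (m + l - int i) (mode v (n + int i) w)
             - sc (isign l) (mode v (n + l - int i) (mode u (m + int i) w))))"
  using vertex_algebra unfolding vertex_algebra_def by (elim conjE) simp

lemma vac_in: "vac \<in> Vg 0"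
  and mode_in: "u \<in> Vg m \<Longrightarrow> v \<in> Vg n \<Longrightarrow> mode u r v \<in> Vg (m + n - r - 1)"
  using Z_graded_VA unfolding Z_graded_VA_def by blast+

lemma Lm_0: "Lm 0 v = v" and Lp_0: "Lp 0 v = v"
  and Lp_Lp: "Lp m (Lp n v) = sc (of_nat ((m + n) choose n)) (Lp (m + n) v)"
  and Lp_Lm: "v \<in> Vg d \<Longrightarrow>
        Lp a (Lm b v) = (\<Sum>k\<le>min a b. sc (of_int ((-1) ^ k * ibinom (-2 * d + int a - int b) k))
                                          (Lm (b - k) (Lp (a - k) v)))"
  and Lp_in: "v \<in> Vg d \<Longrightarrow> Lp r v \<in> Vg (d - int r)"
  using weight_H_module unfolding weight_H_module_def by blast+

lemma Lp_add: "Lp r (x + y) = Lp r x + Lp r y"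
  and Lp_scale: "Lp r (sc a x) = sc a (Lp r x)"
  and Lm_add: "Lm r (x + y) = Lm r x + Lm r y"
  using weight_H_module unfolding weight_H_module_def Vector_Spaces.linear_def module_hom_def module_hom_axioms_def
  by simp_all

lemma Lm_eq_mode: "Lm n v = mode v (- int n - 1) vac"
  and bounded_below: "\<exists>N. \<forall>n<N. Vg n = {0}"
  and Lp_vac: "Lp n vac = (if n = 0 then vac else 0)"
  and conjugation: "v \<in> Vg d \<Longrightarrow>
        (\<Sum>a\<le>N. sc ((-1) ^ (N - a)) (Lp a (mode v (- M - 1) (Lp (N - a) w))))
      = (\<Sum>j\<le>N. sc (of_int ((-1) ^ j * ibinom (int N - 2 * d - M) j))
                    (mode (Lp (N - j) v) (int j - M - 1) w))"
  using H unfolding H_module_VA_def Dop_def by blast+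

lemma additive_Lp: "additive (Lp r)"
  and additive_mode_left: "additive (\<lambda>u. mode u n v)"
  and additive_mode_right: "additive (\<lambda>v. mode u n v)"
  by (simp_all add: additive_def Lp_add mode_add_left mode_add_right)

lemmas Lp_zero [simp] = additive.zero[OF additive_Lp]
  and mode_zero_left [simp] = additive.zero[OF additive_mode_left]
  and mode_sum_left = additive.sum[OF additive_mode_left]
  and mode_zero_right [simp] = additive.zero[OF additive_mode_right]
  and mode_sum_right = additive.sum[OF additive_mode_right]

section \<open>Homogeneous components and truncation\<close>

lemma subspace_Vg: "vs.subspace (Vg n)"
  using graded by (simp add: graded_def)

lemmas zero_in [simp] = vs.subspace_0[OF subspace_Vg]
  and add_in = vs.subspace_add[OF subspace_Vg]
  and scale_in = vs.subspace_scale[OF subspace_Vg]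
  and sum_in = vs.subspace_sum[OF subspace_Vg]

lemma comp_props:
  "finite {n. comp Vg n v \<noteq> 0}" "comp Vg n v \<in> Vg n"
  "v = (\<Sum>n | comp Vg n v \<noteq> 0. comp Vg n v)"
proof -
  have "\<exists>!c. finite {n. c n \<noteq> 0} \<and> (\<forall>n. c n \<in> Vg n) \<and> v = sum c {n. c n \<noteq> 0}"
    using graded by (simp add: graded_def)
  from theI'[OF this] show "finite {n. comp Vg n v \<noteq> 0}" "comp Vg n v \<in> Vg n"
    "v = (\<Sum>n | comp Vg n v \<noteq> 0. comp Vg n v)"
    unfolding comp_def by blast+
qed

lemma comp_eqI:
  assumes "finite A" "\<And>n. c n \<in> Vg n" "\<And>n. n \<notin> A \<Longrightarrow> c n = 0" "v = sum c A"
  shows "comp Vg n v = c n"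
proof -
  have "\<exists>!c. finite {n. c n \<noteq> 0} \<and> (\<forall>n. c n \<in> Vg n) \<and> v = sum c {n. c n \<noteq> 0}"
    using graded by (simp add: graded_def)
  moreover have "finite {n. c n \<noteq> 0}" using assms by (metis (mono_tags) finite_subset mem_Collect_eq subsetI)
  moreover have "v = sum c {n. c n \<noteq> 0}"
    unfolding assms(4) by (rule sum.mono_neutral_right) (use assms in auto)
  ultimately show ?thesis unfolding comp_def using assms(2)
    by (subst the1_equality[where a = c]) auto
qed

lemma comp_hom: "v \<in> Vg d \<Longrightarrow> comp Vg n v = (if n = d then v else 0)"
  by (rule comp_eqI[of "{d}"]) auto

lemma comp_sum:
  assumes "finite A" "{n. comp Vg n v \<noteq> 0} \<subseteq> A"
  shows "(\<Sum>n\<in>A. comp Vg n v) = v"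
  by (subst (2) comp_props(3)[of v], rule sum.mono_neutral_right) (use assms in auto)

lemma comp_add: "comp Vg n (x + y) = comp Vg n x + comp Vg n y"
proof (rule comp_eqI)
  let ?A = "{n. comp Vg n x \<noteq> 0} \<union> {n. comp Vg n y \<noteq> 0}"
  show "finite ?A" by (simp add: comp_props)
  then show "x + y = (\<Sum>n\<in>?A. comp Vg n x + comp Vg n y)"
    by (simp add: sum.distrib comp_sum)
qed (auto intro: add_in comp_props)

lemma comp_scale: "comp Vg n (sc a x) = sc a (comp Vg n x)"
proof (rule comp_eqI)
  let ?A = "{n. comp Vg n x \<noteq> 0}"
  show "finite ?A" by (simp add: comp_props)
  then show "sc a x = (\<Sum>n\<in>?A. sc a (comp Vg n x))"
    by (simp add: comp_sum flip: vs.scale_sum_right)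
qed (auto intro: scale_in comp_props)

text \<open>Every vector is the finite sum of its components; the empty sum is covered by
  \<open>hom\<close>, as 0 is homogeneous.\<close>

lemma hom_induct [case_names hom add]:
  assumes "\<And>d v. v \<in> Vg d \<Longrightarrow> P v" "\<And>x y. P x \<Longrightarrow> P y \<Longrightarrow> P (x + y)"
  shows "P v"
proof -
  have "P (\<Sum>n\<in>A. comp Vg n v)" if "finite A" for A
    using that by induction (auto intro: assms comp_props)
  then show ?thesis using comp_props(1,3)[of v] by metis
qed

lemma fsum_comp_add:
  assumes "\<And>n x y. x \<in> Vg n \<Longrightarrow> y \<in> Vg n \<Longrightarrow> g n (x + y) = (g n x + g n y :: 'a::ab_group_add)"
  shows "fsum (\<lambda>n. g n (comp Vg n (x + y))) = fsum (\<lambda>n. g n (comp Vg n x)) + fsum (\<lambda>n. g n (comp Vg n y))"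
proof -
  have g0: "g n 0 = 0" for n using assms[of 0 n 0] by simp
  let ?A = "{n. comp Vg n x \<noteq> 0} \<union> {n. comp Vg n y \<noteq> 0}"
  have fin: "finite ?A" by (simp add: comp_props)
  show ?thesis
    by (subst (1 2 3) fsum_eq_sum[OF fin]) (auto simp: comp_add g0 assms comp_props sum.distrib)
qed

lemma fsum_comp_hom:
  assumes "v \<in> Vg d" "\<And>n. g n 0 = 0"
  shows "fsum (\<lambda>n. g n (comp Vg n v)) = g d v"
  by (subst fsum_single[of d]) (auto simp: comp_hom[OF assms(1)] assms(2))

lemma L0op_add: "L0op sc Vg j (x + y) = L0op sc Vg j x + L0op sc Vg j y"
  unfolding L0op_def by (rule fsum_comp_add) (simp add: vs.scale_right_distrib)

lemma L0op_hom: "v \<in> Vg d \<Longrightarrow> L0op sc Vg j v = sc (of_int (ibinom (-2 * d) j)) v"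
  unfolding L0op_def by (rule fsum_comp_hom) auto

lemma L0op_0: "L0op sc Vg 0 v = v"
  by (induction v rule: hom_induct) (simp_all add: L0op_hom L0op_add)

text \<open>\<open>Lp k\<close> lowers the degree by \<open>k\<close>, and the grading is bounded
  below.\<close>

lemma Lp_trunc: "\<exists>K. \<forall>k\<ge>K. Lp k v = 0"
proof (induction v rule: hom_induct)
  case (hom d v)
  obtain N where N: "\<And>n. n < N \<Longrightarrow> Vg n = {0}" using bounded_below by blast
  have "Lp k v = 0" if "k \<ge> nat (d - N + 1)" for k
    using Lp_in[OF hom, of k] N[of "d - int k"] that by auto
  then show ?case by blast
next
  case (add x y)
  then obtain K L where "\<forall>k\<ge>K. Lp k x = 0" "\<forall>k\<ge>L. Lp k y = 0" by blast
  then show ?case by (intro exI[of _ "max K L"]) (simp add: Lp_add)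
qed

lemma eventually_mode_0: "\<forall>\<^sub>F i in sequentially. mode u (l + int i) v = 0"
proof -
  obtain N where "\<And>n. n \<ge> N \<Longrightarrow> mode u n v = 0" using mode_trunc by blast
  then show ?thesis unfolding eventually_sequentially
    by (intro exI[of _ "nat (N - l)"]) auto
qed

text \<open>Both sides are cut at the same \<open>I\<close>, and every large \<open>I\<close> works,
  so finitely many instances can share one bound.\<close>

lemma eventually_borcherds:
  "\<forall>\<^sub>F I in sequentially.
    (\<Sum>i<I. sc (of_int (ibinom m i)) (mode (mode u (l + int i) v) (m + n - int i) w))
    = (\<Sum>i<I. sc (of_int ((-1) ^ i * ibinom l i))
            (mode u (m + l - int i) (mode v (n + int i) w)
             - sc (isign l) (mode v (n + l - int i) (mode u (m + int i) w))))"
proof -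
  have 1: "\<forall>\<^sub>F i in sequentially.
      sc (of_int (ibinom m i)) (mode (mode u (l + int i) v) (m + n - int i) w) = 0"
    using eventually_mode_0[of u l v] by eventually_elim simp
  have 2: "\<forall>\<^sub>F i in sequentially. sc (of_int ((-1) ^ i * ibinom l i))
            (mode u (m + l - int i) (mode v (n + int i) w)
             - sc (isign l) (mode v (n + l - int i) (mode u (m + int i) w))) = 0"
    using eventually_mode_0[of u m w] eventually_mode_0[of v n w] by eventually_elim simp
  show ?thesis using eventually_fsum[OF 1] eventually_fsum[OF 2]
    by eventually_elim (metis borcherds)
qed

text \<open>Coefficient form of
  \<open>e\<^bsup>zL\<^esup> Y(v,z\<^sub>0) = Y(e\<^bsup>z(1 - zz\<^sub>0)L\<^esup> (1 - zz\<^sub>0)\<^bsup>-2 deg\<^esup> v, z\<^sub>0/(1 - zz\<^sub>0)) e\<^bsup>zL\<^esup>\<close> with \<open>L = L\<^sub>1\<close>.\<close>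
lemma Lp_mode:
  assumes v: "v \<in> Vg d"
  shows "Lp s (mode v l u) = (\<Sum>(k, q, i) | k + q + i = s.
    sc (of_int (ibinom (2 * d - l - int k - 2) i)) (mode (Lp k v) (l + int i) (Lp q u)))"
proof -
  define X where "X a = Lp a (mode v l (Lp (s - a) u))" for a
  \<comment> \<open>The left side of the conjugation axiom is composed with \<open>e^(zL)\<close> on
    the right, which cancels \<open>e^(-zL)\<close>: the alternating binomial sums leave only
    \<open>a = s\<close>.\<close>
  have "(\<Sum>N\<le>s. \<Sum>a\<le>N. sc ((-1) ^ (N - a)) (Lp a (mode v l (Lp (N - a) (Lp (s - N) u)))))
      = (\<Sum>N\<le>s. \<Sum>a\<le>N. sc ((-1) ^ (N - a) * of_nat (s - a choose (N - a))) (X a))"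
    by (intro sum.cong refl)
       (simp add: Lp_Lp X_def Lp_scale mode_scale_right binomial_symmetric[of "s - _" "s - a" for a])
  also have "\<dots> = (\<Sum>(a, b) | a + b \<le> s. sc ((-1) ^ b * of_nat (s - a choose b)) (X a))"
    by (subst sum.triangle_reindex_eq) simp
  also have "{(a, b). a + b \<le> s} = Sigma {..s} (\<lambda>a. {..s - a})" by auto
  also have "(\<Sum>(a, b)\<in>Sigma {..s} (\<lambda>a. {..s - a}). sc ((-1) ^ b * of_nat (s - a choose b)) (X a))
      = (\<Sum>a\<le>s. sc (\<Sum>b\<le>s - a. (-1) ^ b * of_nat (s - a choose b)) (X a))"
    by (subst sum.Sigma[symmetric]) (auto simp: vs.scale_sum_left)
  also have "\<dots> = (\<Sum>a\<in>{s}. X a)"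
    by (rule sum.mono_neutral_cong_right) (auto simp: choose_alternating_sum)
  also have "\<dots> = Lp s (mode v l u)" by (simp add: X_def Lp_0)
  finally have "Lp s (mode v l u) =
    (\<Sum>N\<le>s. \<Sum>a\<le>N. sc ((-1) ^ (N - a)) (Lp a (mode v l (Lp (N - a) (Lp (s - N) u)))))" ..
  also have "\<dots> = (\<Sum>N\<le>s. \<Sum>j\<le>N. sc (of_int ((-1) ^ j * ibinom (int N - 2 * d + l + 1) j))
                    (mode (Lp (N - j) v) (l + int j) (Lp (s - N) u)))"
    using conjugation[OF v, where M = "- l - 1"] by (simp add: algebra_simps)
  also have "\<dots> = (\<Sum>(N, j)\<in>Sigma {..s} (\<lambda>N. {..N}). sc (of_int ((-1) ^ j * ibinom (int N - 2 * d + l + 1) j))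
                    (mode (Lp (N - j) v) (l + int j) (Lp (s - N) u)))"
    by (simp add: sum.Sigma)
  also have "\<dots> = (\<Sum>(k, q, i) | k + q + i = s.
    sc (of_int (ibinom (2 * d - l - int k - 2) i)) (mode (Lp k v) (l + int i) (Lp q u)))"
  proof (rule sum.reindex_bij_witness[where i = "\<lambda>(k, q, i). (k + i, i)" and j = "\<lambda>(N, j). (N - j, s - N, j)"], goal_cases)
    case (5 x)
    obtain N j where x: "x = (N, j)" "j \<le> N" using 5 by auto
    then have "int N - 2 * d + l + 1 = int j - (2 * d - l - int (N - j) - 2) - 1" by simp
    then show ?case unfolding x by (simp only: ibinom_negated_upper prod.case)
  qed auto
  finally show ?thesis .
qed

section \<open>Adjoint modes\<close>

text \<open>\<open>adj d v n\<close> is the coefficient of \<open>z\<^bsup>-n-1\<^esup>\<close> in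
  \<open>Y(e\<^bsup>zL\<^esup> (-z\<^bsup>-2\<^esup>)\<^bsup>deg\<^esup> v, z\<^bsup>-1\<^esup>)\<close> with \<open>L = L\<^sub>1\<close>, for \<open>v\<close> homogeneous of degree \<open>d\<close>.\<close>
definition adj :: "int \<Rightarrow> 'v \<Rightarrow> int \<Rightarrow> 'v \<Rightarrow> 'v" where
  "adj d v n w = sc (isign d) (fsum (\<lambda>k. mode (Lp k v) (2 * d - n - int k - 2) w))"

lemma adj_eq:
  assumes "\<And>k. k \<ge> K \<Longrightarrow> Lp k v = 0"
  shows "adj d v n w = sc (isign d) (\<Sum>k<K. mode (Lp k v) (2 * d - n - int k - 2) w)"
  unfolding adj_def by (subst fsum_eq_sum[of "{..<K}"]) (use assms in auto)

lemma adj_add_left: "adj d (x + y) n w = adj d x n w + adj d y n w"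
proof -
  obtain K L where KL: "\<And>k. k \<ge> K \<Longrightarrow> Lp k x = 0" "\<And>k. k \<ge> L \<Longrightarrow> Lp k y = 0"
    using Lp_trunc by metis
  show ?thesis
    by (subst (1 2 3) adj_eq[where K = "max K L"])
       (auto simp: KL Lp_add mode_add_left sum.distrib vs.scale_right_distrib)
qed

lemma adj_scale_left: "adj d (sc a x) n w = sc a (adj d x n w)"
proof -
  obtain K where K: "\<And>k. k \<ge> K \<Longrightarrow> Lp k x = 0"
    using Lp_trunc by metis
  show ?thesis
    by (subst (1 2) adj_eq[where K = K])
       (auto simp: K Lp_scale mode_scale_left mult.commute simp flip: vs.scale_sum_right)
qed

lemma adj_add_right: "adj d v n (x + y) = adj d v n x + adj d v n y"
proof -
  obtain K where K: "\<And>k. k \<ge> K \<Longrightarrow> Lp k v = 0"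
    using Lp_trunc by metis
  show ?thesis
    by (subst (1 2 3) adj_eq[where K = K])
       (auto simp: K mode_add_right sum.distrib vs.scale_right_distrib)
qed

lemma adj_scale_right: "adj d v n (sc a x) = sc a (adj d v n x)"
proof -
  obtain K where K: "\<And>k. k \<ge> K \<Longrightarrow> Lp k v = 0"
    using Lp_trunc by metis
  show ?thesis
    by (subst (1 2) adj_eq[where K = K])
       (auto simp: K mode_scale_right mult.commute simp flip: vs.scale_sum_right)
qed

lemma adj_zero_left [simp]: "adj d 0 n w = 0"
  using adj_scale_left[of d 0 0 n w] by simp

lemma adj_in:
  assumes "v \<in> Vg d" "w \<in> Vg e"
  shows "adj d v n w \<in> Vg (e + n + 1 - d)"
proof -
  obtain K where K: "\<And>k. k \<ge> K \<Longrightarrow> Lp k v = 0"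
    using Lp_trunc by metis
  have "mode (Lp k v) (2 * d - n - int k - 2) w \<in> Vg (e + n + 1 - d)" for k
    using mode_in[OF Lp_in[OF assms(1)] assms(2), of k "2 * d - n - int k - 2"]
    by (simp add: algebra_simps)
  then show ?thesis by (subst adj_eq[OF K]) (auto intro!: scale_in sum_in)
qed

lemma adj_vac: "adj 0 vac (-1) w = w"
  by (subst adj_eq[of 1]) (auto simp: Lp_vac mode_vac isign_def)

text \<open>The case \<open>m = 0\<close>, \<open>n = -1\<close> of the opposite Borcherds identity satisfied by the adjoint modes:
  each summand of the double expansion is an instance of the Borcherds identity, and
  \<open>Lp_mode\<close> collects the results.\<close>
lemma adj_mode:
  assumes v: "v \<in> Vg d" and u: "u \<in> Vg e"
  shows "\<exists>I>0. adj (d + e - l - 1) (mode v l u) (-1) w =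
    (\<Sum>i<I. sc (of_int ((-1) ^ i * ibinom l i))
      (adj e u (int i - 1) (adj d v (l - int i) w)
       - sc (isign l) (adj d v (int i) (adj e u (l - 1 - int i) w))))"
proof -
  obtain K where K: "\<And>k. k \<ge> K \<Longrightarrow> Lp k v = 0" "\<And>k. k \<ge> K \<Longrightarrow> Lp k u = 0"
  proof -
    obtain K1 K2 where "\<And>k. k \<ge> K1 \<Longrightarrow> Lp k v = 0" "\<And>k. k \<ge> K2 \<Longrightarrow> Lp k u = 0"
      using Lp_trunc by metis
    then show ?thesis by (intro that[of "max K1 K2"]) auto
  qed
  \<comment> \<open>\<open>AC\<close> and \<open>CA\<close> are the two orders of the modes of
    \<open>Lp k v\<close> and \<open>Lp q u\<close> in the Borcherds identity, and \<open>G\<close>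
    is a summand of its other side.\<close>
  define CA where "CA k q i =
    mode (Lp q u) (2 * e - 1 - int q - int i) (mode (Lp k v) (2 * d - l - int k - 2 + int i) w)" for k q i
  define AC where "AC k q i =
    mode (Lp k v) (2 * d - int k - 2 - int i) (mode (Lp q u) (2 * e - l - 1 - int q + int i) w)" for k q i
  define G where "G k q i = sc (of_int (ibinom (2 * d - l - int k - 2) i))
    (mode (mode (Lp k v) (l + int i) (Lp q u)) (2 * d + 2 * e - 2 * l - 3 - int k - int q - int i) w)" for k q i
  define X where "X k q i = mode (Lp k v) (l + int i) (Lp q u)" for k q i
  \<comment> \<open>The parameter \<open>m = 2 * d - l - k - 2\<close> is the upper index of the
    binomial in \<open>Lp_mode\<close>, so the two expansions match.\<close>
  have 1: "\<forall>\<^sub>F I in sequentially. (\<Sum>i<I. G k q i) =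
      (\<Sum>i<I. sc (of_int ((-1) ^ i * ibinom l i)) (AC k q i - sc (isign l) (CA k q i)))" for k q
    using eventually_borcherds[of "2 * d - l - int k - 2" "Lp k v" l "Lp q u" "2 * e - l - 1 - int q" w]
    unfolding G_def AC_def CA_def by (simp add: algebra_simps)
  have 2: "\<forall>\<^sub>F I in sequentially. \<forall>i\<ge>I. X k q i = 0" for k q
    using eventually_mode_0[of "Lp k v" l "Lp q u"] unfolding X_def
    by (rule eventually_all_ge_at_top)
  have "\<forall>\<^sub>F I in sequentially. \<forall>k\<in>{..<K}. \<forall>q\<in>{..<K}. (\<Sum>i<I. G k q i) =
      (\<Sum>i<I. sc (of_int ((-1) ^ i * ibinom l i)) (AC k q i - sc (isign l) (CA k q i))) \<and>
      (\<forall>i\<ge>I. X k q i = 0)"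
    by (intro eventually_ball_finite ballI eventually_conj 1 2 finite_lessThan)
  \<comment> \<open>\<open>I > 0\<close> keeps the summand \<open>i = 0\<close>, the one that
    survives in \<open>F_adj_mode\<close>.\<close>
  then have "\<forall>\<^sub>F I in sequentially. I > 0 \<and> (\<forall>k\<in>{..<K}. \<forall>q\<in>{..<K}. (\<Sum>i<I. G k q i) =
      (\<Sum>i<I. sc (of_int ((-1) ^ i * ibinom l i)) (AC k q i - sc (isign l) (CA k q i))) \<and>
      (\<forall>i\<ge>I. X k q i = 0))"
    using eventually_gt_at_top[of 0] by eventually_elim blast
  then obtain I where I: "I > 0"
    "\<And>k q. k < K \<Longrightarrow> q < K \<Longrightarrow> (\<Sum>i<I. G k q i) =
      (\<Sum>i<I. sc (of_int ((-1) ^ i * ibinom l i)) (AC k q i - sc (isign l) (CA k q i)))"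
    "\<And>k q i. k < K \<Longrightarrow> q < K \<Longrightarrow> i \<ge> I \<Longrightarrow> X k q i = 0"
    by (auto simp: eventually_sequentially)
  have X0: "X k q i = 0" if "k \<ge> K \<or> q \<ge> K \<or> i \<ge> I" for k q i
    using that I(3)[of k q i] by (cases "k < K"; cases "q < K") (auto simp: X_def K)
  \<comment> \<open>If \<open>k + q + i\<close> reaches this bound, one of the three indices is past
    its own bound and the term vanishes.\<close>
  define S where "S = 2 * K + I"
  have LpS: "Lp s (mode v l u) = 0" if "s \<ge> S" for s
    unfolding Lp_mode[OF v]
  proof (intro sum.neutral ballI)
    fix x assume x: "x \<in> {(k, q, i). k + q + i = s}"
    obtain k q i where kqi: "x = (k, q, i)" by (cases x)
    have "k \<ge> K \<or> q \<ge> K \<or> i \<ge> I" using x that kqi by (auto simp: S_def)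
    from X0[OF this] show "(case x of (k, q, i) \<Rightarrow> sc (of_int (ibinom (2 * d - l - int k - 2) i))
      (mode (Lp k v) (l + int i) (Lp q u))) = 0" by (simp add: kqi X_def)
  qed
  have finT: "finite {(k, q, i). k + q + i = (s::nat)}" for s
    by (rule finite_subset[of _ "{..s} \<times> {..s} \<times> {..s}"]) auto
  have "adj (d + e - l - 1) (mode v l u) (-1) w = sc (isign (d + e - l - 1)) (\<Sum>s<S.
      mode (Lp s (mode v l u)) (2 * d + 2 * e - 2 * l - 3 - int s) w)"
  proof -
    have "2 * (d + e - l - 1) - (-1) - int s - 2 = 2 * d + 2 * e - 2 * l - 3 - int s" for s
      by simp
    then show ?thesis by (simp only: adj_eq[OF LpS])
  qed
  also have "(\<Sum>s<S. mode (Lp s (mode v l u)) (2 * d + 2 * e - 2 * l - 3 - int s) w)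
      = (\<Sum>s<S. \<Sum>(k, q, i) | k + q + i = s. G k q i)"
    unfolding Lp_mode[OF v] mode_sum_left
    by (intro sum.cong refl) (auto simp: G_def mode_scale_left algebra_simps)
  also have "\<dots> = (\<Sum>(k, q, i)\<in>(\<Union>s<S. {(k, q, i). k + q + i = s}). G k q i)"
    by (rule sum.UNION_disjoint[symmetric]) (use finT in auto)
  also have "\<dots> = (\<Sum>(k, q, i)\<in>{..<K} \<times> {..<K} \<times> {..<I}. G k q i)"
  proof (rule sum.mono_neutral_right, goal_cases)
    case 3
    have G0: "G k q i = 0" if "k \<ge> K \<or> q \<ge> K \<or> i \<ge> I" for k q i
      using X0[OF that] by (simp add: G_def X_def)
    show ?case
    proof
      fix x assume x: "x \<in> (\<Union>s<S. {(k, q, i). k + q + i = s}) - {..<K} \<times> {..<K} \<times> {..<I}"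
      obtain k q i where kqi: "x = (k, q, i)" by (cases x)
      with x have "k \<ge> K \<or> q \<ge> K \<or> i \<ge> I" by auto
      from G0[OF this] show "(case x of (k, q, i) \<Rightarrow> G k q i) = 0" by (simp add: kqi)
    qed
  qed (use finT in \<open>auto simp: S_def\<close>)
  also have "\<dots> = (\<Sum>k<K. \<Sum>q<K. \<Sum>i<I. G k q i)"
    by (simp add: sum.cartesian_product)
  also have "sc (isign (d + e - l - 1)) \<dots> = (\<Sum>k<K. \<Sum>q<K. \<Sum>i<I.
      sc (isign (d + e - l - 1)) (sc (of_int ((-1) ^ i * ibinom l i)) (AC k q i - sc (isign l) (CA k q i))))"
    by (simp add: I(2) vs.scale_sum_right)
  also have "\<dots> = (\<Sum>k<K. \<Sum>q<K. \<Sum>i<I. sc (of_int ((-1) ^ i * ibinom l i))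
      (sc (isign d * isign e) (CA k q i - sc (isign l) (AC k q i))))"
  proof (intro sum.cong refl)
    fix k q i
    \<comment> \<open>The degree shift contributes the factor \<open>- isign l\<close>, which
      exchanges the two orders; hence the opposite identity.\<close>
    have "sc (isign (d + e - l - 1)) (AC k q i - sc (isign l) (CA k q i))
      = sc (isign d * isign e) (CA k q i - sc (isign l) (AC k q i))"
      by (simp add: isign_diff isign_add isign_1 vs.scale_right_diff_distrib vs.scale_left_commute mult.assoc)
    then show "sc (isign (d + e - l - 1)) (sc (of_int ((-1) ^ i * ibinom l i)) (AC k q i - sc (isign l) (CA k q i)))
      = sc (of_int ((-1) ^ i * ibinom l i)) (sc (isign d * isign e) (CA k q i - sc (isign l) (AC k q i)))"
      by (subst vs.scale_left_commute) (simp only:)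
  qed
  also have "\<dots> = (\<Sum>i<I. \<Sum>k<K. \<Sum>q<K. sc (of_int ((-1) ^ i * ibinom l i))
      (sc (isign d * isign e) (CA k q i - sc (isign l) (AC k q i))))"
    by (simp only: sum.swap[where A = "{..<K}" and B = "{..<I}"])
  also have "\<dots> = (\<Sum>i<I. sc (of_int ((-1) ^ i * ibinom l i))
      (adj e u (int i - 1) (adj d v (l - int i) w)
       - sc (isign l) (adj d v (int i) (adj e u (l - 1 - int i) w))))"
  proof (intro sum.cong refl)
    fix i
    have a: "adj e u (int i - 1) (adj d v (l - int i) w) = (\<Sum>k<K. \<Sum>q<K. sc (isign d * isign e) (CA k q i))"
      by (subst sum.swap)
         (simp add: adj_eq[OF K(1)] adj_eq[OF K(2)] CA_def mode_scale_right mode_sum_right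
            algebra_simps flip: vs.scale_sum_right)
    have b: "adj d v (int i) (adj e u (l - 1 - int i) w) = (\<Sum>k<K. \<Sum>q<K. sc (isign d * isign e) (AC k q i))"
      by (simp add: adj_eq[OF K(1)] adj_eq[OF K(2)] AC_def mode_scale_right mode_sum_right
            algebra_simps flip: vs.scale_sum_right)
    show "(\<Sum>k<K. \<Sum>q<K. sc (of_int ((-1) ^ i * ibinom l i))
      (sc (isign d * isign e) (CA k q i - sc (isign l) (AC k q i)))) =
      sc (of_int ((-1) ^ i * ibinom l i))
      (adj e u (int i - 1) (adj d v (l - int i) w)
       - sc (isign l) (adj d v (int i) (adj e u (l - 1 - int i) w)))"
      unfolding a b
      by (simp add: vs.scale_right_diff_distrib sum_subtractf vs.scale_sum_right mult_ac)
  qed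
  finally show ?thesis using I(1) by blast
qed

section \<open>Forms for which \<open>adj\<close> is the adjoint\<close>

text \<open>Isolates the vertex operator half of invariance, which already determines
  \<open>B\<close> from \<open>B vac\<close>.\<close>

definition adjoint_form :: "('v \<Rightarrow> 'v \<Rightarrow> 'k) \<Rightarrow> bool" where
  "adjoint_form B \<longleftrightarrow> bilinear_form sc B \<and>
    (\<forall>d n v w w'. v \<in> Vg d \<longrightarrow> B (mode v n w) w' = B w (adj d v n w'))"

lemma additive_bilinear:
  assumes "bilinear_form sc B"
  shows "additive (B w)" "additive (\<lambda>w. B w w')"
  using assms by (auto simp: bilinear_form_def additive_def)

text \<open>Reconciles the sum of scalars in \<open>invariant_form\<close> with the sum of vectors
  in \<open>adj\<close>; both stop where \<open>Lp k v\<close> vanishes.\<close>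

lemma bilinear_adj:
  assumes "bilinear_form sc B"
  shows "B w (adj d v n w') = isign d * fsum (\<lambda>k. B w (mode (Lp k v) (2 * d - n - int k - 2) w'))"
proof -
  obtain K where K: "\<And>k. k \<ge> K \<Longrightarrow> Lp k v = 0"
    using Lp_trunc by metis
  note add = additive_bilinear(1)[OF assms]
  have "fsum (\<lambda>k. B w (mode (Lp k v) (2 * d - n - int k - 2) w'))
      = (\<Sum>k<K. B w (mode (Lp k v) (2 * d - n - int k - 2) w'))"
    by (rule fsum_eq_sum) (auto simp: K additive.zero[OF add])
  moreover have "B w (sc a x) = a * B w x" for a x
    using assms by (simp add: bilinear_form_def)
  ultimately show ?thesis
    by (simp add: adj_eq[OF K] additive.sum[OF add])
qed

lemma invariant_form_iff:
  "invariant_form sc Vg mode Lm Lp B \<longleftrightarrow> adjoint_form B \<and>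
    (\<forall>i j k w w'. B (Hbasis_act sc Vg Lm Lp i j k w) w' = B w (Hbasis_act sc Vg Lm Lp k j i w'))"
  unfolding invariant_form_def adjoint_form_def using bilinear_adj by auto

end

section \<open>Functionals that can occur as pairing with the vacuum\<close>

text \<open>Models an element of the dual space as a functional on all of V, zero outside degree 0.
  Here \<open>'a\<close> is the field and \<open>'b\<close> the type of vectors.\<close>

locale vacuum_functional = H_VA +
  fixes F :: "'b \<Rightarrow> 'a"
  assumes F_add: "F (x + y) = F x + F y"
    and F_scale: "F (sc a x) = a * F x"
    and F_degree: "x \<in> Vg d \<Longrightarrow> d \<noteq> 0 \<Longrightarrow> F x = 0"
    and F_Lp: "k > 0 \<Longrightarrow> F (Lp k x) = 0"
begin

lemma additive_F: "additive F" by (simp add: additive_def F_add)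

lemmas F_zero [simp] = additive.zero[OF additive_F]
  and F_sum = additive.sum[OF additive_F]
  and F_diff = additive.diff[OF additive_F]

text \<open>Apply \<open>F\<close> to the conjugation axiom: on its left side \<open>F_Lp\<close>
  kills every term with \<open>a > 0\<close>.\<close>

lemma F_Lp_right:
  assumes v: "v \<in> Vg d"
  shows "(-1) ^ N * F (mode v m (Lp N w)) =
    (\<Sum>i\<le>N. of_int ((-1) ^ i * ibinom (int N - 2 * d + m + 1) i) * F (mode (Lp (N - i) v) (m + int i) w))"
proof -
  have "F (\<Sum>a\<le>N. sc ((-1) ^ (N - a)) (Lp a (mode v m (Lp (N - a) w)))) =
    (\<Sum>a\<in>{0}. (-1) ^ (N - a) * F (Lp a (mode v m (Lp (N - a) w))))"
    unfolding F_sum F_scale by (rule sum.mono_neutral_right) (auto simp: F_Lp)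
  moreover have "(\<Sum>a\<le>N. sc ((-1) ^ (N - a)) (Lp a (mode v m (Lp (N - a) w)))) =
    (\<Sum>i\<le>N. sc (of_int ((-1) ^ i * ibinom (int N - 2 * d + m + 1) i)) (mode (Lp (N - i) v) (m + int i) w))"
    using conjugation[OF v, where N = N and M = "- m - 1" and w = w] by (simp add: algebra_simps)
  ultimately show ?thesis by (simp add: F_sum F_scale Lp_0)
qed

text \<open>Dual to the translation covariance
  \<open>e\<^bsup>xD\<^esup> Y(v,z) e\<^bsup>-xD\<^esup> = Y(v,z + x)\<close>; the coefficients match by Vandermonde convolution.\<close>
lemma F_adj_Lp:
  assumes v: "v \<in> Vg d"
  shows "(-1) ^ j * F (adj d v n (Lp j w)) = of_int (ibinom n j) * F (adj d v (n - int j) w)"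
proof -
  obtain K where K: "\<And>k. k \<ge> K \<Longrightarrow> Lp k v = 0"
    using Lp_trunc by metis
  define X where "X s = F (mode (Lp s v) (2 * d - n + int j - int s - 2) w)" for s
  have X0: "X s = 0" if "s \<ge> K" for s using K that by (simp add: X_def)
  define c where "c k i = (of_int ((-1) ^ i * ibinom (int j + int k - n - 1) i) * of_nat (j - i + k choose k) :: 'a)" for k i
  have "(-1) ^ j * F (mode (Lp k v) (2 * d - n - int k - 2) (Lp j w)) = (\<Sum>i\<le>j. c k i * X (k + (j - i)))" for k
    unfolding F_Lp_right[OF Lp_in[OF v]]
  proof (intro sum.cong refl)
    fix i assume "i \<in> {..j}"
    then show "of_int ((-1) ^ i * ibinom (int j - 2 * (d - int k) + (2 * d - n - int k - 2) + 1) i) *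
       F (mode (Lp (j - i) (Lp k v)) (2 * d - n - int k - 2 + int i) w) = c k i * X (k + (j - i))"
      by (simp add: Lp_Lp mode_scale_left F_scale c_def X_def algebra_simps)
  qed
  then have "(-1) ^ j * F (adj d v n (Lp j w)) = isign d * (\<Sum>k<K. \<Sum>i\<le>j. c k i * X (k + (j - i)))"
    by (simp add: adj_eq[OF K] F_scale F_sum sum_distrib_left mult.left_commute)
  also have "(\<Sum>k<K. \<Sum>i\<le>j. c k i * X (k + (j - i))) = (\<Sum>i\<le>j. \<Sum>k<K. c k i * X (k + (j - i)))"
    by (rule sum.swap)
  also have "\<dots> = (\<Sum>i\<le>j. \<Sum>s<K. of_int (ibinom (n - int s) i * ibinom (int s) (j - i)) * X s)"
  proof (rule sum.cong[OF refl])
    fix i assume i: "i \<in> {..j}"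
    show "(\<Sum>k<K. c k i * X (k + (j - i))) = (\<Sum>s<K. of_int (ibinom (n - int s) i * ibinom (int s) (j - i)) * X s)"
    \<comment> \<open>With \<open>s = k + (j - i)\<close>, unmatched \<open>k\<close> have
      \<open>X s = 0\<close> because \<open>s \<ge> K\<close>, and unmatched \<open>s\<close> have
      \<open>binom(s, j - i) = 0\<close>.\<close>
    proof (rule sum.reindex_bij_witness_not_neutral[where j = "\<lambda>k. k + (j - i)" and i = "\<lambda>s. s - (j - i)"
          and S' = "{k. k < K \<and> k + (j - i) \<ge> K}" and T' = "{s. s < K \<and> s < j - i}"], goal_cases)
      case (9 k)
      have "(-1) ^ i * ibinom (int j + int k - n - 1) i = ibinom (n - int (k + (j - i))) i"
        using ibinom_negated_upper[of i "n - int (k + (j - i))"] i by (simp add: algebra_simps)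
      moreover have "j - i + k choose k = k + (j - i) choose (j - i)"
        by (metis add.commute add_diff_cancel_right' binomial_symmetric le_add2)
      ultimately show ?case by (simp add: c_def del: of_nat_add)
    qed (auto simp: X0 binomial_eq_0)
  qed
  also have "\<dots> = (\<Sum>s<K. of_int (\<Sum>i\<le>j. ibinom (n - int s) i * ibinom (int s) (j - i)) * X s)"
    by (subst sum.swap) (simp add: sum_distrib_right)
  also have "\<dots> = of_int (ibinom n j) * (\<Sum>s<K. X s)"
    by (simp only: ibinom_Vandermonde diff_add_cancel sum_distrib_left)
  also have "isign d * \<dots> = of_int (ibinom n j) * F (adj d v (n - int j) w)"
    by (simp add: adj_eq[OF K] F_scale F_sum X_def algebra_simps)
  finally show ?thesis .
qed

text \<open>The coefficient \<open>binom(p\<^sup>k - 1, j) = \<plusminus>1\<close> is invertible for arbitrarily large \<open>j\<close>, whereas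
  \<open>L\<^sub>1\<^bsup>(j)\<^esup> w = 0\<close> eventually.\<close>
lemma F_adj_nonneg:
  assumes v: "v \<in> Vg d" and "n \<ge> 0"
  shows "F (adj d v n w) = 0"
proof -
  obtain K where K: "\<And>k. k \<ge> K \<Longrightarrow> Lp k w = 0"
    using Lp_trunc by metis
  let ?p = "CHAR('a)" and ?k = "nat n + K + 1"
  have "?k < ?p ^ ?k" using prime_gt_1_nat[OF prime_char] by (intro power_gt_expt) simp
  \<comment> \<open>\<open>F_adj_Lp\<close> is used at index \<open>n + j = p^k - 1\<close>; the
    choice of \<open>?k\<close> ensures \<open>j \<ge> K\<close>, so its left side is zero.\<close>
  define j where "j = ?p ^ ?k - 1 - nat n"
  have j: "nat n + j = ?p ^ ?k - 1" "j \<ge> K" "j < ?p ^ ?k"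
    using \<open>?k < ?p ^ ?k\<close> by (auto simp: j_def)
  have "of_int (ibinom (n + int j) j) * F (adj d v n w) = 0"
    using F_adj_Lp[OF v, of j "n + int j" w] K[OF j(2)] adj_scale_right[of d v "n + int j" 0 0] by simp
  moreover have "n + int j = int (?p ^ ?k - 1)" using assms(2) j(1) by linarith
  then have "of_int (ibinom (n + int j) j) = (of_nat ((?p ^ ?k - 1) choose j) :: 'a)"
    by (simp only: ibinom_int of_int_of_nat_eq)
  ultimately show ?thesis
    using choose_prime_power_minus_one[OF prime_char refl j(3)] by simp
qed

text \<open>In \<open>adj_mode\<close> every outer adjoint mode has index at least 0, hence is
  killed by \<open>F\<close>, except \<open>adj e u (-1)\<close> at \<open>i = 0\<close>.\<close>

lemma F_adj_mode:
  assumes v: "v \<in> Vg d" and u: "u \<in> Vg e"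
  shows "F (adj (d + e - l - 1) (mode v l u) (-1) w) = F (adj e u (-1) (adj d v l w))"
proof -
  obtain I where "I > 0" and I: "adj (d + e - l - 1) (mode v l u) (-1) w =
    (\<Sum>i<I. sc (of_int ((-1) ^ i * ibinom l i))
      (adj e u (int i - 1) (adj d v (l - int i) w)
       - sc (isign l) (adj d v (int i) (adj e u (l - 1 - int i) w))))"
    using adj_mode[OF v u] by blast
  have "F (adj (d + e - l - 1) (mode v l u) (-1) w) =
    (\<Sum>i\<in>{0}. of_int ((-1) ^ i * ibinom l i) * F (adj e u (int i - 1) (adj d v (l - int i) w)))"
    unfolding I F_sum F_scale F_diff
    by (rule sum.mono_neutral_cong_right)
       (use \<open>I > 0\<close> in \<open>auto simp: F_adj_nonneg[OF v] F_adj_nonneg[OF u]\<close>)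
  then show ?thesis by simp
qed

section \<open>The form built from a functional, and its invariance\<close>

text \<open>\<open>adj\<close> depends on the degree, so the left argument is split into
  components.\<close>

definition form :: "'b \<Rightarrow> 'b \<Rightarrow> 'a" where
  "form u w = fsum (\<lambda>d. F (adj d (comp Vg d u) (-1) w))"

lemma form_hom: "u \<in> Vg d \<Longrightarrow> form u w = F (adj d u (-1) w)"
  unfolding form_def by (rule fsum_comp_hom) auto

lemma form_add_left: "form (x + y) w = form x w + form y w"
  unfolding form_def by (rule fsum_comp_add) (simp add: adj_add_left F_add)

lemma form_add_right: "form u (x + y) = form u x + form u y"
  by (induction u rule: hom_induct) (simp_all add: form_hom form_add_left adj_add_right F_add)

lemma form_scale_left: "form (sc a x) w = a * form x w"
  by (induction x rule: hom_induct)
     (simp_all add: form_hom[OF scale_in] form_hom form_add_left adj_scale_left F_scale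
        vs.scale_right_distrib distrib_left)

lemma form_scale_right: "form u (sc a x) = a * form u x"
  by (induction u rule: hom_induct)
     (simp_all add: form_hom form_add_left adj_scale_right F_scale distrib_left)

lemma bilinear_form: "bilinear_form sc form"
  by (simp add: bilinear_form_def form_add_left form_add_right form_scale_left form_scale_right)

lemmas form_zero_right = additive.zero[OF additive_bilinear(1)[OF bilinear_form]]
  and form_sum_left = additive.sum[OF additive_bilinear(2)[OF bilinear_form]]
  and form_sum_right = additive.sum[OF additive_bilinear(1)[OF bilinear_form]]

lemma form_vac_left: "form vac w = F w"
  by (simp add: form_hom[OF vac_in] adj_vac)

lemma form_mode: "v \<in> Vg d \<Longrightarrow> form (mode v n u) w = form u (adj d v n w)"
proof (induction u rule: hom_induct)
  case (hom e u)
  then show ?case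
    by (simp add: form_hom[OF mode_in[OF hom(2,1)]] form_hom[OF hom(1)] F_adj_mode)
qed (simp add: mode_add_right form_add_left)

lemma adjoint_form_form: "adjoint_form form"
  by (simp add: adjoint_form_def bilinear_form form_mode)

lemma adjoint_form_unique:
  assumes B: "adjoint_form B" and vac: "B vac = F"
  shows "B = form"
proof (intro ext)
  fix u w
  show "B u w = form u w"
  proof (induction u rule: hom_induct)
    case (hom d u)
    have "B (mode u (-1) vac) w = F (adj d u (-1) w)"
      using B hom vac by (simp add: adjoint_form_def)
    then show ?case by (simp add: mode_creation form_hom[OF hom])
  next
    case (add x y)
    then show ?case using B by (simp add: adjoint_form_def bilinear_form_def form_add_left)
  qed
qed

text \<open>The vector to which \<open>F\<close> is applied has degree \<open>e - d\<close>.\<close>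

lemma form_orthogonal:
  assumes "u \<in> Vg d" "w \<in> Vg e" "d \<noteq> e"
  shows "form u w = 0"
  using F_degree[OF adj_in[OF assms(1,2)]] assms(3) by (simp add: form_hom[OF assms(1)])

text \<open>On \<open>V\<^sub>0\<close> the operators \<open>L\<^sub>-\<^sub>1\<^bsup>(k)\<^esup>\<close> and \<open>L\<^sub>1\<^bsup>(k)\<^esup>\<close> commute.\<close>
lemma form_vac_right: "form w vac = F w"
proof (induction w rule: hom_induct)
  case (hom d w)
  show ?case
  proof (cases "d = 0")
    case False
    then show ?thesis using form_orthogonal[OF hom vac_in] F_degree[OF hom] by simp
  next
    case True
    then have w: "w \<in> Vg 0" using hom by simp
    obtain K where K: "\<And>k. k \<ge> K \<Longrightarrow> Lp k w = 0"
      using Lp_trunc by metis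
    have comm: "Lp k (Lm k w) = Lm k (Lp k w)" for k
    proof -
      have "Lp k (Lm k w) = (\<Sum>i\<in>{0}. sc (of_int ((-1) ^ i * ibinom 0 i)) (Lm (k - i) (Lp (k - i) w)))"
        by (simp only: Lp_Lm[OF w]) (rule sum.mono_neutral_cong_right; auto simp: ibinom_0_left)
      then show ?thesis by simp
    qed
    \<comment> \<open>Modes on the vacuum are the operators \<open>Lm k\<close>; commuting
      \<open>Lp k\<close> to the outside lets \<open>F\<close> kill all \<open>k > 0\<close>. The
      bound \<open>Suc K\<close> ensures that \<open>k = 0\<close> occurs.\<close>
    have "form w vac = (\<Sum>k<Suc K. F (mode (Lp k w) (- int k - 1) vac))"
      by (subst form_hom[OF w], subst adj_eq[of "Suc K"])
         (auto simp: K F_sum F_scale isign_def minus_diff_commute[of "int _" 1] intro!: sum.cong)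
    also have "\<dots> = (\<Sum>k<Suc K. F (Lp k (Lm k w)))"
      by (simp only: comm flip: Lm_eq_mode)
    also have "\<dots> = (\<Sum>k\<in>{0}. F (Lp k (Lm k w)))"
      by (rule sum.mono_neutral_right) (auto simp: F_Lp)
    finally show ?thesis by (simp add: Lp_0 Lm_0)
  qed
qed (simp add: form_add_left F_add)

text \<open>Taking adjoints twice restores the mode: the two exponentials of \<open>L_1\<close>
  carry opposite signs, so they cancel.\<close>

lemma form_adj_left:
  assumes v: "v \<in> Vg d"
  shows "form (adj d v n u) w = form u (mode v n w)"
proof -
  obtain K0 where "\<And>k. k \<ge> K0 \<Longrightarrow> Lp k v = 0"
    using Lp_trunc by metis
  then obtain K where "K > 0" and K: "\<And>k. k \<ge> K \<Longrightarrow> Lp k v = 0"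
    by (metis Suc_leD zero_less_Suc)
  define X where "X s = form u (mode (Lp s v) (n - int s) w)" for s
  have inner: "form (mode (Lp k v) (2 * d - n - int k - 2) u) w
      = isign d * (-1) ^ k * (\<Sum>l<K. of_nat (l + k choose k) * X (l + k))" for k
  proof -
    have "Lp l (Lp k v) = 0" if "l \<ge> K" for l using K[of "l + k"] that by (simp add: Lp_Lp)
    then have "form (mode (Lp k v) (2 * d - n - int k - 2) u) w = isign (d - int k) *
        (\<Sum>l<K. form u (mode (Lp l (Lp k v)) (2 * (d - int k) - (2 * d - n - int k - 2) - int l - 2) w))"
      by (simp only: form_mode[OF Lp_in[OF v]] adj_eq[of K] form_scale_right form_sum_right)
    then show ?thesis
      by (simp add: Lp_Lp mode_scale_left form_scale_right isign_diff isign_of_nat X_def algebra_simps)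
  qed
  have "form (adj d v n u) w = (\<Sum>k<K. (-1) ^ k * (\<Sum>l<K. of_nat (l + k choose k) * X (l + k)))"
    by (simp add: adj_eq[OF K] form_scale_left form_sum_left inner sum_distrib_left mult.assoc[symmetric])
  also have "\<dots> = (\<Sum>(k, l)\<in>{..<K} \<times> {..<K}. (-1) ^ k * of_nat (l + k choose k) * X (l + k))"
    by (simp add: sum_distrib_left mult.assoc sum.cartesian_product)
  \<comment> \<open>The square is enlarged to a triangle, where \<open>X\<close> vanishes on the
    added terms, so that each diagonal carries a full alternating binomial sum.\<close>
  also have "\<dots> = (\<Sum>(k, l) | k + l < 2 * K. (-1) ^ k * of_nat (l + k choose k) * X (l + k))"
  proof (rule sum.mono_neutral_left, goal_cases)
    case 1
    show ?case by (rule finite_subset[of _ "{..<2 * K} \<times> {..<2 * K}"]) auto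
  next
    case 3
    have "X (l + k) = 0" if "k \<ge> K \<or> l \<ge> K" for k l
      using K[of "l + k"] that by (auto simp: X_def form_zero_right)
    then show ?case by (auto; metis not_le_imp_less)
  qed auto
  also have "\<dots> = (\<Sum>s<2 * K. (\<Sum>k\<le>s. (-1) ^ k * of_nat (s choose k)) * X s)"
    by (simp add: sum.triangle_reindex sum_distrib_right)
  also have "\<dots> = (\<Sum>s\<in>{0}. X s)"
    by (rule sum.mono_neutral_cong_right) (use \<open>K > 0\<close> in \<open>auto simp: choose_alternating_sum X_def Lp_0 form_zero_right\<close>)
  finally show ?thesis by (simp add: X_def Lp_0)
qed

lemma form_sym: "form u w = form w u"
proof (induction u rule: hom_induct)
  case (hom d u)
  have "form u w = form (adj d u (-1) w) vac"
    by (simp add: form_hom[OF hom] form_vac_right)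
  then show ?case by (simp add: form_adj_left[OF hom] mode_creation)
qed (simp add: form_add_left form_add_right)

text \<open>\<open>Lm r u\<close> is the mode \<open>-1 - r\<close> of \<open>u\<close> on the
  vacuum; in \<open>F_adj_Lp\<close> at \<open>n = -1\<close> the binomial is \<open>(-1)^r\<close>
  and cancels the sign.\<close>

lemma form_Lm: "form (Lm r u) w = form u (Lp r w)"
proof (induction u rule: hom_induct)
  case (hom d u)
  have "form (Lm r u) w = F (adj d u (-1 - int r) w)"
    by (simp add: Lm_eq_mode form_mode[OF hom] form_vac_left minus_diff_commute[of "int r" 1])
  also have "\<dots> = F (adj d u (-1) (Lp r w))"
    using F_adj_Lp[OF hom, of r "-1" w] by (simp add: ibinom_minus_one)
  finally show ?case by (simp add: form_hom[OF hom])
qed (simp add: Lm_add form_add_left)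

lemma form_Lp: "form (Lp r u) w = form u (Lm r w)"
  by (metis form_Lm form_sym)

lemma form_L0op: "form (L0op sc Vg j u) w = form u (L0op sc Vg j w)"
proof (induction u rule: hom_induct)
  case (hom d u)
  show ?case
  proof (induction w rule: hom_induct)
    case (hom e w)
    then show ?case
      using form_orthogonal[OF \<open>u \<in> Vg d\<close> hom]
      by (cases "d = e") (simp_all add: L0op_hom[OF \<open>u \<in> Vg d\<close>] L0op_hom form_scale_left form_scale_right)
  qed (simp add: L0op_add form_add_right)
qed (simp add: L0op_add form_add_left)

lemma invariant_form_form: "invariant_form sc Vg mode Lm Lp form"
  by (simp add: invariant_form_iff adjoint_form_form Hbasis_act_def form_Lm form_Lp form_L0op)

end

section \<open>Passage between invariant forms and the dual space\<close>

context H_VA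
begin

text \<open>All \<open>L_0^(j)\<close> are used to kill nonzero degrees, as \<open>j = 1\<close>
  sees at most the degree modulo the characteristic. \<open>F_Lp\<close> holds because
  \<open>Lp k\<close> is adjoint to \<open>Lm k\<close>, which kills the vacuum for
  \<open>k > 0\<close>.\<close>

lemma invariant_form_vacuum_functional:
  assumes B: "invariant_form sc Vg mode Lm Lp B"
  shows "vacuum_functional sc Vg vac mode Lm Lp (B vac)"
proof
  have bil: "bilinear_form sc B" using B by (simp add: invariant_form_def)
  show "B vac (x + y) = B vac x + B vac y" "B vac (sc a x) = a * B vac x" for x y a
    using bil by (simp_all add: bilinear_form_def)
  have act: "B (Hbasis_act sc Vg Lm Lp i j k w) w' = B w (Hbasis_act sc Vg Lm Lp k j i w')" for i j k w w'
    using B by (simp add: invariant_form_def)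
  show "B vac x = 0" if x: "x \<in> Vg d" "d \<noteq> 0" for x d
  proof (rule ccontr)
    assume "B vac x \<noteq> 0"
    have "of_int (ibinom 0 j) * B vac x = of_int (ibinom (-2 * d) j) * B vac x" for j
      using act[of 0 j 0 vac x] bil L0op_hom[OF vac_in, of j] L0op_hom[OF x(1), of j]
      by (simp add: Hbasis_act_def Lm_0 Lp_0 bilinear_form_def)
    with \<open>B vac x \<noteq> 0\<close> have "(of_int (ibinom 0 j) :: 'k) = of_int (ibinom (-2 * d) j)" for j
      by simp
    from ibinom_separates[OF this] x(2) show False by simp
  qed
  show "B vac (Lp k x) = 0" if "k > 0" for k x
  proof -
    have "Lm k vac = 0" using that by (simp add: Lm_eq_mode mode_vac)
    then show ?thesis
      using act[of k 0 0 vac x] additive.zero[OF additive_bilinear(2)[OF bil]]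
      by (simp add: Hbasis_act_def Lm_0 Lp_0 L0op_0)
  qed
qed

text \<open>\<open>f\<close> is linear only on \<open>Vg 0\<close>, so it is composed with the
  projection to degree 0.\<close>

lemma quot_dual_vacuum_functional:
  assumes f: "f \<in> quot_dual sc Vg Lp"
  shows "vacuum_functional sc Vg vac mode Lm Lp (\<lambda>x. f (comp Vg 0 x))"
proof
  have add: "f (x + y) = f x + f y" if "x \<in> Vg 0" "y \<in> Vg 0" for x y
    using f that by (simp add: quot_dual_def)
  have "f (0 + 0) = f 0 + f 0" by (rule add) simp_all
  then have f0: "f 0 = 0" by (metis add.right_neutral add_left_imp_eq)
  show "f (comp Vg 0 (x + y)) = f (comp Vg 0 x) + f (comp Vg 0 y)" for x y
    by (simp add: comp_add add comp_props)
  show "f (comp Vg 0 (sc a x)) = a * f (comp Vg 0 x)" for a x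
    using f by (simp add: comp_scale quot_dual_def comp_props)
  show "f (comp Vg 0 x) = 0" if "x \<in> Vg d" "d \<noteq> 0" for x d
    using that by (simp add: comp_hom[OF that(1)] f0)
  show "f (comp Vg 0 (Lp k x)) = 0" if k: "k > 0" for k x
  proof (induction x rule: hom_induct)
    case (hom d x)
    have "Lp k x \<in> L1plus sc Lp"
      unfolding L1plus_def by (rule vs.span_base, rule UN_I[of k]) (use k in auto)
    moreover have "Lp k x \<in> Vg 0" if "0 = d - int k"
      using Lp_in[OF hom, of k] that by simp
    ultimately show ?case
      using f by (auto simp: comp_hom[OF Lp_in[OF hom]] f0 quot_dual_def)
  qed (simp add: Lp_add comp_add add comp_props)
qed

lemma vacuum_functional_L1plus:
  assumes "vacuum_functional sc Vg vac mode Lm Lp F" "x \<in> L1plus sc Lp"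
  shows "F x = 0"
proof -
  interpret vacuum_functional sc Vg vac mode Lm Lp F by (rule assms)
  show ?thesis using assms(2) unfolding L1plus_def
    by (induction rule: vs.span_induct_alt) (auto simp: F_add F_scale F_Lp)
qed

end

theorem theorem4p10:
  fixes p :: nat
    and sc :: "'k::field \<Rightarrow> 'v::ab_group_add \<Rightarrow> 'v"
    and Vg :: "int \<Rightarrow> 'v set" and vac :: 'v and mode :: "'v \<Rightarrow> int \<Rightarrow> 'v \<Rightarrow> 'v"
    and Lm Lp :: "nat \<Rightarrow> 'v \<Rightarrow> 'v"
  assumes "prime p" and "odd p" and "CHAR('k) = p" and "alg_closed TYPE('k)"
    and "H_module_VA sc Vg vac mode Lm Lp"
  shows "(\<forall>B. invariant_form sc Vg mode Lm Lp B \<longrightarrow> (\<forall>x y. B x y = B y x)) \<and>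
         (\<exists>\<Phi>. bij_betw \<Phi> {B. invariant_form sc Vg mode Lm Lp B} (quot_dual sc Vg Lp) \<and>
               (\<forall>B\<in>{B. invariant_form sc Vg mode Lm Lp B}. \<forall>B'\<in>{B. invariant_form sc Vg mode Lm Lp B}.
                  \<forall>a. \<Phi> (\<lambda>x y. a * B x y + B' x y) = (\<lambda>x. a * \<Phi> B x + \<Phi> B' x)))"
proof -
  interpret H_VA sc Vg vac mode Lm Lp
    using assms by unfold_locales simp_all
  let ?I = "{B. invariant_form sc Vg mode Lm Lp B}"
  \<comment> \<open>Pairing with the vacuum, cut down to degree 0 because \<open>quot_dual\<close>
    extends functionals by zero.\<close>
  define \<Phi> where "\<Phi> B x = (if x \<in> Vg 0 then B vac x else 0)" for B :: "'v \<Rightarrow> 'v \<Rightarrow> 'k" and x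
  have eq_form: "B = vacuum_functional.form sc Vg mode Lp (B vac)"
    if "invariant_form sc Vg mode Lm Lp B" for B
  proof -
    interpret vacuum_functional sc Vg vac mode Lm Lp "B vac"
      by (rule invariant_form_vacuum_functional[OF that])
    show ?thesis
      using that by (intro adjoint_form_unique) (simp_all add: invariant_form_iff)
  qed
  have sym: "B x y = B y x" if "invariant_form sc Vg mode Lm Lp B" for B x y
    using vacuum_functional.form_sym[OF invariant_form_vacuum_functional[OF that], of x y]
    by (simp flip: eq_form[OF that])
  \<comment> \<open>Shows that \<open>\<Phi> B\<close> still determines \<open>B vac\<close>, which
    gives injectivity.\<close>
  have comp0: "F (comp Vg 0 x) = F x" if "vacuum_functional sc Vg vac mode Lm Lp F" for F x
  proof -
    interpret vacuum_functional sc Vg vac mode Lm Lp F by (rule that)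
    show ?thesis
      by (induction x rule: hom_induct) (auto simp: comp_hom comp_add F_add F_degree)
  qed
  have "\<Phi> B \<in> quot_dual sc Vg Lp" if "B \<in> ?I" for B
  proof -
    interpret vacuum_functional sc Vg vac mode Lm Lp "B vac"
      using that by (simp add: invariant_form_vacuum_functional)
    show ?thesis
      using vacuum_functional_L1plus[OF invariant_form_vacuum_functional] that
      by (auto simp: quot_dual_def \<Phi>_def F_add F_scale add_in scale_in)
  qed
  moreover have "inj_on \<Phi> ?I"
  proof (rule inj_onI)
    fix B B' assume B: "B \<in> ?I" "B' \<in> ?I" and eq: "\<Phi> B = \<Phi> B'"
    have "B vac x = B' vac x" for x
    proof -
      have "B vac (comp Vg 0 x) = B' vac (comp Vg 0 x)"
        using fun_cong[OF eq, of "comp Vg 0 x"] by (simp add: \<Phi>_def comp_props)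
      then show ?thesis
        using B by (simp add: comp0[OF invariant_form_vacuum_functional])
    qed
    then have "B vac = B' vac" by blast
    then show "B = B'" using eq_form[of B] eq_form[of B'] B by simp
  qed
  moreover have "f \<in> \<Phi> ` ?I" if f: "f \<in> quot_dual sc Vg Lp" for f
  proof -
    interpret vacuum_functional sc Vg vac mode Lm Lp "\<lambda>x. f (comp Vg 0 x)"
      by (rule quot_dual_vacuum_functional[OF f])
    have "f x = \<Phi> form x" for x
      using f by (cases "x \<in> Vg 0") (simp_all add: \<Phi>_def form_vac_left comp_hom quot_dual_def)
    then show ?thesis using invariant_form_form by blast
  qed
  ultimately have "bij_betw \<Phi> ?I (quot_dual sc Vg Lp)"
    by (auto simp: bij_betw_def)
  moreover have "\<Phi> (\<lambda>x y. a * B x y + B' x y) = (\<lambda>x. a * \<Phi> B x + \<Phi> B' x)" for a B B'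
    by (auto simp: \<Phi>_def)
  ultimately show ?thesis using sym by blast
qed

end
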